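(* Let $1<k<\frac{2}{\sqrt3}$ and let $F_4:\mathbb{R}^2\to\mathbb{R}^2$ be defined by $$F_4(x,y)=\left(-\frac{ky^3}{1+x^2+y^2},\ \frac{kx^3}{1+x^2+y^2}\right).$$ The map $F_4$ has the following properties: 1) $F_4$ is of class $C^1$. 2) $F_4$ is a homeomorphism. 3) $\mathrm{Fix}(F_4)=\{0\}$. 4) $F_4^4(P)=P$ for $P=\left((k-1)^{-1/2},0\right)$, with $F_4^j(P)=R_4^j(P)\ne P$ for $j=2,3$. 5) $0$ is a local attractor. 6) $F_4$ is $\mathbb{Z}_4$-equivariant. 7) The restriction of $F_4$ to any line ray is a homeomorphism onto another line ray. 8) $F_4\left(\overline{S_{j,4}}\right)=\overline{S_{j+1,4}}$ for $j=1,\dots,4\pmod 4$, with $F_4\left(\partial S_{j,4}\right)=\partial S_{j+1,4}$. 9) The curve $\theta\mapsto F_4(\cos\theta,\sin\theta)$, $0\le\theta<2\pi$, goes across each line ray and is transverse to line rays at all points with $\theta\ne\frac{m\pi}{2}$, $m=0,1,2,3$.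
   Context: $R_4(x,y)=(-y,x)$ is the rotation by $\pi/2$ generating the action of $\mathbb{Z}_4$ on $\mathbb{R}^2$; a map $f$ is $\mathbb{Z}_4$-equivariant if $f(\gamma x)=\gamma f(x)$ for all $\gamma\in\mathbb{Z}_4$, $x\in\mathbb{R}^2$. $F^j$ denotes the $j$-th iterate and $\mathrm{Fix}$ the set of fixed points. A fixed point is a local attractor if it is asymptotically stable (Lyapunov stable and attracting all points in some neighbourhood of it under forward iteration). A line ray is a half line through the origin of the form $\{t(a,b): t\ge0\}$ with $0\ne(a,b)\in\mathbb{R}^2$. The sectors are $S_{1,4}=\{(r\cos\theta,r\sin\theta): r>0,\ 0<\theta<\pi/2\}$ and $S_{j,4}=R_4(S_{j-1,4})$ for $j=2,3,4$, with $S_{5,4}=S_{1,4}$ (indices modulo 4); bars denote closures and $\partial$ boundaries. A curve goes across a line ray if it meets the ray and passes from one side of it to the other there; it is transverse to line rays at a point if its tangent vector there is linearly independent of the direction of the line ray through that point. *)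

theory Defs
  imports "HOL-Analysis.Analysis"
begin

type_synonym plane = "real \<times> real"

definition R4 :: "plane \<Rightarrow> plane" where
  "R4 = (\<lambda>(x, y). (- y, x))"

definition F4 :: "real \<Rightarrow> plane \<Rightarrow> plane" where
  "F4 k = (\<lambda>(x, y). (- (k * y ^ 3 / (1 + x\<^sup>2 + y\<^sup>2)), k * x ^ 3 / (1 + x\<^sup>2 + y\<^sup>2)))"

definition of_class_C1 :: "('a::real_normed_vector \<Rightarrow> 'b::real_normed_vector) \<Rightarrow> bool" where
  "of_class_C1 f \<longleftrightarrow>
     (\<exists>f' :: 'a \<Rightarrow> ('a \<Rightarrow>\<^sub>L 'b).
        (\<forall>x. (f has_derivative blinfun_apply (f' x)) (at x)) \<and> continuous_on UNIV f')"

definition Fix :: "('a \<Rightarrow> 'a) \<Rightarrow> 'a set" where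
  "Fix f = {x. f x = x}"

definition local_attractor :: "('a::metric_space \<Rightarrow> 'a) \<Rightarrow> 'a \<Rightarrow> bool" where
  "local_attractor f p \<longleftrightarrow>
     p \<in> Fix f \<and>
     (\<forall>\<epsilon>>0. \<exists>\<delta>>0. \<forall>x\<in>ball p \<delta>. \<forall>n. (f ^^ n) x \<in> ball p \<epsilon>) \<and>
     (\<exists>\<delta>>0. \<forall>x\<in>ball p \<delta>. (\<lambda>n. (f ^^ n) x) \<longlonglongrightarrow> p)"

text \<open>The group of order 4 generated by \<open>R4\<close>, as a set of transformations of the plane.\<close>

definition Z4 :: "(plane \<Rightarrow> plane) set" where
  "Z4 = {R4 ^^ j |j. j < 4}"

definition Z4_equivariant :: "(plane \<Rightarrow> plane) \<Rightarrow> bool" where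
  "Z4_equivariant f \<longleftrightarrow> (\<forall>\<gamma>\<in>Z4. \<forall>x. f (\<gamma> x) = \<gamma> (f x))"

definition ray :: "plane \<Rightarrow> plane set" where
  "ray u = {t *\<^sub>R u |t. t \<ge> 0}"

definition line_ray :: "plane set \<Rightarrow> bool" where
  "line_ray L \<longleftrightarrow> (\<exists>u. u \<noteq> 0 \<and> L = ray u)"

definition sector :: "int \<Rightarrow> plane set" where
  "sector j = (R4 ^^ nat ((j - 1) mod 4)) `
     {(r * cos \<theta>, r * sin \<theta>) |r \<theta>. r > 0 \<and> 0 < \<theta> \<and> \<theta> < pi / 2}"

lemma sector_1: "sector 1 = {(r * cos \<theta>, r * sin \<theta>) |r \<theta>. r > 0 \<and> 0 < \<theta> \<and> \<theta> < pi / 2}"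
  by (simp add: sector_def)

lemma sector_step: "j \<in> {2, 3, 4} \<Longrightarrow> sector j = R4 ` sector (j - 1)"
  by (elim insertE emptyE; simp add: sector_def image_image numeral_2_eq_2 numeral_3_eq_3)

lemma sector_5: "sector 5 = sector 1"
  by (simp add: sector_def)

text \<open>
  The sign of \<open>side u p\<close> tells on which side of the directed line spanned by \<open>u\<close> the point \<open>p\<close> lies:
  positive on the left, negative on the right, zero on the line.
\<close>

definition side :: "plane \<Rightarrow> plane \<Rightarrow> real" where
  "side u p = fst u * snd p - snd u * fst p"

text \<open>
  At its endpoint \<open>0\<close> a half line does not separate the plane locally, so crossing is only
  meaningful at points \<open>c s \<noteq> 0\<close>.
\<close>

definition crosses_at :: "(real \<Rightarrow> plane) \<Rightarrow> plane \<Rightarrow> real \<Rightarrow> bool" where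
  "crosses_at c u s \<longleftrightarrow>
     c s \<in> ray u \<and> c s \<noteq> 0 \<and>
     ((\<forall>\<^sub>F t in at_left s. side u (c t) < 0) \<and> (\<forall>\<^sub>F t in at_right s. side u (c t) > 0) \<or>
      (\<forall>\<^sub>F t in at_left s. side u (c t) > 0) \<and> (\<forall>\<^sub>F t in at_right s. side u (c t) < 0))"

text \<open>
  The parameter set \<open>I\<close> selects the points of the curve; the one-sided neighbourhoods in
  \<open>crosses_at\<close> are taken in the whole line. For a closed curve, given as a periodic function
  with \<open>I\<close> one period, this makes crossings at the initial point of \<open>I\<close> count correctly.
\<close>

definition goes_across :: "real set \<Rightarrow> (real \<Rightarrow> plane) \<Rightarrow> plane \<Rightarrow> bool" where
  "goes_across I c u \<longleftrightarrow>
     (\<exists>s\<in>I. c s \<in> ray u) \<and> (\<forall>s\<in>I. c s \<in> ray u \<longrightarrow> crosses_at c u s)"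

text \<open>
  The condition \<open>v \<noteq> u\<close> is needed because \<open>independent\<close> is a property of sets: \<open>{v, u}\<close> collapses
  to a singleton when \<open>v = u\<close>.
\<close>

definition transverse_to_rays_at :: "(real \<Rightarrow> plane) \<Rightarrow> real \<Rightarrow> bool" where
  "transverse_to_rays_at c s \<longleftrightarrow>
     (\<exists>v. (c has_vector_derivative v) (at s) \<and>
          (\<forall>u. u \<noteq> 0 \<and> c s \<in> ray u \<longrightarrow> v \<noteq> u \<and> independent {v, u}))"

end

theory Submission
  imports Defs
begin

text \<open>
  Everything rests on polar-like coordinates. Write \<open>C(x, y) = (-y\<^sup>3, x\<^sup>3)\<close>, the function
  \<open>cube_dir\<close> below; it is a bijection of the plane because real cube roots exist, and it is
  homogeneous of degree three. The map \<open>F4 k\<close> is \<open>C\<close> multiplied by the rotation-invariant positive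
  factor \<open>k / (1 + \<parallel>u\<parallel>\<^sup>2)\<close>, so it sends the ray through \<open>u\<close> into the ray through \<open>C u\<close>, and on that
  ray it acts by the scalar function \<open>t \<mapsto> k t\<^sup>3 / (1 + \<parallel>u\<parallel>\<^sup>2 t\<^sup>2)\<close>, which is a strictly increasing
  bijection of the nonnegative half line (\<open>F4_ray\<close>, \<open>F4_image_ray\<close>).

  Since \<open>C\<close> permutes the directions, \<open>F4 k\<close> is a continuous bijection of the plane, and invariance of
  domain makes it a homeomorphism (\<open>homeomorphism_F4\<close>); its restrictions to rays and its effect on
  closures and boundaries of sectors are then consequences. For the sectors it remains to compare signs of
  coordinates on the open first quadrant and to carry the result around by equivariance
  (\<open>F4_image_sector\<close>).

  A vector \<open>u \<noteq> 0\<close> and its image are never parallel, because their determinant is a positive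
  multiple of \<open>x\<^sup>4 + y\<^sup>4\<close>. This excludes nonzero fixed points and invariant rays. On the axes the map
  is a rotation by a right angle composed with a scaling, and the scaling factor is one exactly at distance
  \<open>(k - 1) powr (- 1 / 2)\<close> from the origin, whence the orbit of period four. Near the origin the map is
  cubically small, hence a contraction towards the origin (\<open>local_attractor_F4\<close>).

  The image of the unit circle is the curve \<open>\<theta> \<mapsto> (k / 2) C(cos \<theta>, sin \<theta>)\<close>. The determinant of its
  values at \<open>s\<close> and \<open>t\<close> is a positive multiple of \<open>(cos s sin t)\<^sup>3 - (sin s cos t)\<^sup>3\<close>, and
  because cubing is increasing this has the sign of \<open>sin (t - s)\<close>. So the curve always runs
  counterclockwise around the origin and crosses each ray, even at the four points where its velocity vanishes
  (\<open>circle_image_crosses\<close>). The determinant of position and velocity is a positive multiple of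
  \<open>(sin \<theta> cos \<theta>)\<^sup>2\<close>, which gives transversality elsewhere (\<open>circle_image_transverse\<close>).
\<close>

section \<open>The map along line rays\<close>

definition cube_dir :: "plane \<Rightarrow> plane" where
  "cube_dir u = (- (snd u ^ 3), fst u ^ 3)"

definition root_dir :: "plane \<Rightarrow> plane" where
  "root_dir v = (root 3 (snd v), - root 3 (fst v))"

text \<open>
  The coordinate of the image along \<open>cube_dir u\<close>, as a function of the coordinate \<open>t\<close> along \<open>u\<close>; the
  parameter \<open>n\<close> stands for the squared norm of \<open>u\<close>.
\<close>

definition radial :: "real \<Rightarrow> real \<Rightarrow> real \<Rightarrow> real" where
  "radial k n t = k * t ^ 3 / (1 + n * t\<^sup>2)"

lemma cube_less_iff: "x ^ 3 < y ^ 3 \<longleftrightarrow> x < y" for x y :: real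
  by (metis odd_numeral odd_real_root_power_cancel real_root_less_iff zero_less_numeral)

lemma cube_dir_root_dir [simp]: "cube_dir (root_dir v) = v"
  by (simp add: cube_dir_def root_dir_def odd_real_root_pow)

lemma root_dir_cube_dir [simp]: "root_dir (cube_dir u) = u"
  by (simp add: cube_dir_def root_dir_def odd_real_root_power_cancel real_root_minus)

lemma cube_dir_eq_iff [simp]: "cube_dir u = cube_dir v \<longleftrightarrow> u = v"
  by (metis root_dir_cube_dir)

lemma cube_dir_0 [simp]: "cube_dir 0 = 0"
  by (simp add: cube_dir_def zero_prod_def)

lemma cube_dir_scaleR: "cube_dir (t *\<^sub>R u) = t ^ 3 *\<^sub>R cube_dir u"
  by (simp add: cube_dir_def power_mult_distrib)

lemma norm_plane_squared: "(norm u)\<^sup>2 = (fst u)\<^sup>2 + (snd u)\<^sup>2" for u :: plane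
  by (simp add: norm_prod_def)

lemma F4_eq: "F4 k u = (k / (1 + (norm u)\<^sup>2)) *\<^sub>R cube_dir u"
  by (simp add: F4_def cube_dir_def norm_plane_squared split_beta add.assoc)

lemma F4_ray: "F4 k (t *\<^sub>R u) = radial k ((norm u)\<^sup>2) t *\<^sub>R cube_dir u"
  by (simp add: F4_eq cube_dir_scaleR radial_def power_mult_distrib mult.commute)

lemma radial_nonneg: "0 \<le> k \<Longrightarrow> 0 \<le> n \<Longrightarrow> 0 \<le> t \<Longrightarrow> 0 \<le> radial k n t"
  by (simp add: radial_def)

text \<open>
  Injectivity on a ray. It is enough to compare with \<open>t = 1\<close>, since any nonzero point of a ray can be
  chosen as its direction vector; then \<open>t - 1\<close> can be factored out explicitly.
\<close>

lemma radial_eq_radial_1_iff: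
  assumes "0 < k" "0 \<le> n" "0 \<le> t"
  shows "radial k n t = radial k n 1 \<longleftrightarrow> t = 1"
proof
  assume *: "radial k n t = radial k n 1"
  have "1 + n > 0" "1 + n * t\<^sup>2 > 0"
    using assms by (auto simp: add_pos_nonneg)
  with * assms have "t ^ 3 * (1 + n) = 1 + n * t\<^sup>2"
    by (simp add: radial_def frac_eq_eq) 
  then have "(t - 1) * (t\<^sup>2 + t + 1 + n * t\<^sup>2) = 0"
    by (simp add: algebra_simps power2_eq_square power3_eq_cube)
  moreover have "t\<^sup>2 + t + 1 + n * t\<^sup>2 > 0"
    using assms by (simp add: add_nonneg_pos add_pos_nonneg)
  ultimately show "t = 1" by simp
qed simp

text \<open>
  Intermediate values: the function vanishes at zero and grows at least like \<open>k t / (1 + n)\<close> for \<open>t \<ge> 1\<close>.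
\<close>

lemma radial_surj:
  assumes "0 < k" "0 \<le> n" "0 \<le> s"
  obtains t where "0 \<le> t" "radial k n t = s"
proof -
  \<comment> \<open>Chosen so that \<open>1 \<le> T\<close> and \<open>s \<le> k T / (1 + n)\<close>.\<close>
  define T where "T = 1 + s * (1 + n) / k"
  have "1 \<le> T" using assms by (simp add: T_def)
  have pos: "0 < 1 + n * t\<^sup>2" for t
    using assms by (simp add: add_pos_nonneg)
  have "s * (1 + n * T\<^sup>2) \<le> s * ((1 + n) * T\<^sup>2)"
    using \<open>1 \<le> T\<close> assms by (intro mult_left_mono) (auto simp: distrib_right)
  also have "\<dots> = (s * (1 + n)) * T\<^sup>2" by simp
  also have "\<dots> \<le> (k * T) * T\<^sup>2"
    using assms by (intro mult_right_mono) (auto simp: T_def field_simps)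
  also have "\<dots> = k * T ^ 3" by (simp add: power2_eq_square power3_eq_cube)
  finally have "s \<le> radial k n T"
    using pos[of T] by (simp add: radial_def pos_le_divide_eq)
  moreover have "radial k n 0 \<le> s" using assms by (simp add: radial_def)
  moreover have "continuous_on {0..T} (radial k n)"
    unfolding radial_def using pos by (intro continuous_intros) (metis less_irrefl)
  ultimately obtain t where "0 \<le> t" "radial k n t = s"
    using IVT'[of "radial k n" 0 s T] \<open>1 \<le> T\<close> by auto
  then show thesis by (rule that)
qed

lemma F4_image_ray:
  assumes "0 < k"
  shows "F4 k ` ray u = ray (cube_dir u)"
proof
  show "F4 k ` ray u \<subseteq> ray (cube_dir u)"
    using assms by (force simp: ray_def F4_ray intro: radial_nonneg)
  show "ray (cube_dir u) \<subseteq> F4 k ` ray u"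
  proof
    fix v assume "v \<in> ray (cube_dir u)"
    then obtain s where "0 \<le> s" "v = s *\<^sub>R cube_dir u" by (auto simp: ray_def)
    moreover obtain t where "0 \<le> t" "radial k ((norm u)\<^sup>2) t = s"
      using radial_surj[of k "(norm u)\<^sup>2" s] assms \<open>0 \<le> s\<close> by auto
    ultimately have "v = F4 k (t *\<^sub>R u)" by (simp add: F4_ray)
    with \<open>0 \<le> t\<close> show "v \<in> F4 k ` ray u" by (auto simp: ray_def)
  qed
qed

text \<open>
  The vectors \<open>u\<close> and \<open>cube_dir u\<close> are not parallel: their determinant is the sum of the fourth powers of
  the coordinates of \<open>u\<close>.
\<close>

lemma ray_cube_dir_neq:
  assumes "u \<noteq> 0"
  shows "ray (cube_dir u) \<noteq> ray u"
proof
  assume "ray (cube_dir u) = ray u"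
  moreover have "cube_dir u \<in> ray (cube_dir u)"
    unfolding ray_def by (auto intro!: exI[of _ 1])
  ultimately obtain t where "cube_dir u = t *\<^sub>R u" by (auto simp: ray_def)
  then have "side u (cube_dir u) = 0" by (simp add: side_def)
  then have "fst u ^ 4 + snd u ^ 4 = 0"
    by (simp add: side_def cube_dir_def power_numeral_reduce)
  moreover have "0 \<le> fst u ^ 4" "0 \<le> snd u ^ 4" by simp_all
  ultimately have "fst u = 0" "snd u = 0" by (simp_all add: add_nonneg_eq_0_iff)
  with assms show False by (simp add: prod_eq_iff)
qed

section \<open>The map is a homeomorphism of the plane\<close>

text \<open>
  Points with the same image have cubed directions that are positive multiples of each other, so they lie on a
  common ray, where the radial function separates them.
\<close>

lemma inj_F4:
  assumes "0 < k"
  shows "inj (F4 k)"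
proof (rule injI)
  fix u v assume *: "F4 k u = F4 k v"
  \<comment> \<open>The two scalar factors have quotient \<open>c\<^sup>3\<close>, which \<open>cube_dir\<close> turns into a factor \<open>c\<close> between the points.\<close>
  define c where "c = root 3 ((1 + (norm v)\<^sup>2) / (1 + (norm u)\<^sup>2))"
  have pos: "0 < 1 + (norm w)\<^sup>2" for w :: plane by (simp add: add_pos_nonneg)
  have "0 \<le> c" using pos by (simp add: c_def less_imp_le)
  have "cube_dir v = ((1 + (norm v)\<^sup>2) / k) *\<^sub>R F4 k v"
    using assms pos[of v] by (simp add: F4_eq)
  also have "\<dots> = c ^ 3 *\<^sub>R cube_dir u"
    unfolding *[symmetric] using assms by (simp add: F4_eq c_def odd_real_root_pow)
  also have "\<dots> = cube_dir (c *\<^sub>R u)" by (simp add: cube_dir_scaleR)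
  finally have v: "v = c *\<^sub>R u" by simp
  show "u = v"
  proof (cases "u = 0")
    case False
    then have "cube_dir u \<noteq> 0" by (metis cube_dir_0 cube_dir_eq_iff)
    moreover have "radial k ((norm u)\<^sup>2) 1 *\<^sub>R cube_dir u = radial k ((norm u)\<^sup>2) c *\<^sub>R cube_dir u"
      using * v by (metis F4_ray scaleR_one)
    ultimately have "radial k ((norm u)\<^sup>2) c = radial k ((norm u)\<^sup>2) 1"
      by (metis scaleR_cancel_right)
    with assms \<open>0 \<le> c\<close> have "c = 1" by (simp add: radial_eq_radial_1_iff)
    with v show ?thesis by simp
  qed (simp add: v)
qed

lemma surj_F4:
  assumes "0 < k"
  shows "surj (F4 k)"
proof -
  have "v \<in> range (F4 k)" for v
  proof -
    have "v \<in> ray v" unfolding ray_def by (auto intro!: exI[of _ 1])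
    also have "\<dots> = F4 k ` ray (root_dir v)" using assms by (simp add: F4_image_ray)
    finally show ?thesis by blast
  qed
  then show ?thesis by blast
qed

text \<open>
  Invariance of domain supplies the continuity of the inverse, for which there is no convenient closed formula
  since it involves the root of a cubic equation.
\<close>

lemma homeomorphism_F4:
  assumes "0 < k"
  obtains G where "homeomorphism UNIV UNIV (F4 k) G"
proof -
  have "continuous_on UNIV (F4 k)"
    unfolding F4_eq cube_dir_def
    by (intro continuous_intros) (metis add_pos_nonneg less_irrefl zero_le_power2 zero_less_one)
  then show thesis
    using invariance_of_domain_homeomorphism[of UNIV "F4 k"] inj_F4[OF assms] surj_F4[OF assms] that
    by auto
qed

lemma homeomorphism_image_closure_frontier:
  fixes f :: "'a::topological_space \<Rightarrow> 'b::topological_space"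
  assumes "homeomorphism UNIV UNIV f g"
  shows "f ` closure S = closure (f ` S)" and "f ` frontier S = frontier (f ` S)"
proof -
  have "homeomorphic_maps euclidean euclidean f g"
    using assms by (simp add: homeomorphic_maps_def homeomorphism_def)
  then have hom: "homeomorphic_map euclidean euclidean f"
    by (auto simp: homeomorphic_map_maps)
  show "f ` closure S = closure (f ` S)"
    using homeomorphic_map_closure_of[OF hom, of S] by simp
  show "f ` frontier S = frontier (f ` S)"
    using homeomorphic_map_frontier_of[OF hom, of S] by simp
qed

section \<open>Continuous differentiability\<close>

text \<open>
  The criterion by continuous partial derivatives \<open>p\<close> and \<open>q\<close>: the total derivative is the sum of two
  bounded linear maps that depend linearly and continuously on them, so it is continuous in operator norm.
\<close>

lemma of_class_C1_planeI:
  fixes f :: "plane \<Rightarrow> plane"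
  assumes deriv: "\<And>z. (f has_derivative (\<lambda>h. fst h *\<^sub>R p z + snd h *\<^sub>R q z)) (at z)"
    and cont: "continuous_on UNIV p" "continuous_on UNIV q"
  shows "of_class_C1 f"
  unfolding of_class_C1_def
proof (intro exI conjI allI)
  let ?f' = "\<lambda>z. (blinfun_scaleR_left (p z) o\<^sub>L Blinfun fst) + (blinfun_scaleR_left (q z) o\<^sub>L Blinfun snd)"
  show "(f has_derivative blinfun_apply (?f' z)) (at z)" for z
  proof -
    have "blinfun_apply (?f' z) = (\<lambda>h. fst h *\<^sub>R p z + snd h *\<^sub>R q z)"
      by (simp add: fun_eq_iff blinfun.add_left bounded_linear_Blinfun_apply
          bounded_linear_fst bounded_linear_snd)
    with deriv[of z] show ?thesis by (simp only:)
  qed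
  show "continuous_on UNIV ?f'"
    by (intro continuous_intros cont)
qed

lemma of_class_C1_F4: "of_class_C1 (F4 k)"
proof (rule of_class_C1_planeI)
  define D :: "plane \<Rightarrow> real" where "D = (\<lambda>z. 1 + (fst z)\<^sup>2 + (snd z)\<^sup>2)"
  have "0 < D z" for z
    by (simp add: D_def add_pos_nonneg)
  then have D: "D z \<noteq> 0" for z
    by (metis less_irrefl)
  have contD: "continuous_on UNIV D" unfolding D_def by (intro continuous_intros)
  let ?p = "\<lambda>z::plane. (2 * k * fst z * snd z ^ 3 / (D z)\<^sup>2,
     k * (3 * (fst z)\<^sup>2 * D z - 2 * fst z ^ 4) / (D z)\<^sup>2)"
  let ?q = "\<lambda>z::plane. (- (k * (3 * (snd z)\<^sup>2 * D z - 2 * snd z ^ 4) / (D z)\<^sup>2),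
     - (2 * k * fst z ^ 3 * snd z / (D z)\<^sup>2))"
  show "continuous_on UNIV ?p" "continuous_on UNIV ?q"
    by (intro continuous_intros contD; simp add: D)+
  have eq: "F4 k = (\<lambda>z. (- (k * snd z ^ 3 / D z), k * fst z ^ 3 / D z))"
    by (auto simp: F4_def D_def split_beta)
  have dD: "(D has_derivative (\<lambda>h. 2 * fst z * fst h + 2 * snd z * snd h)) (at z)" for z
    unfolding D_def by (auto intro!: derivative_eq_intros)
  show "(F4 k has_derivative (\<lambda>h. fst h *\<^sub>R ?p z + snd h *\<^sub>R ?q z)) (at z)" for z
    unfolding eq
    apply (rule has_derivative_eq_rhs)
     apply (rule derivative_eq_intros dD refl D)+
    using D[of z]
    by (auto simp: field_simps power2_eq_square power3_eq_cube power_numeral_reduce fun_eq_iff)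
qed

section \<open>The fixed point and its basin\<close>

text \<open>
  A fixed vector would be parallel to its own image, which makes the sum of the fourth powers of its coordinates
  vanish unless the scalar factor does.
\<close>

lemma Fix_F4: "Fix (F4 k) = {0}"
proof -
  have "u = 0" if "F4 k u = u" for u
  proof -
    define c where "c = k / (1 + (norm u)\<^sup>2)"
    have "side u (c *\<^sub>R cube_dir u) = 0"
      using that unfolding F4_eq c_def[symmetric] by (simp add: side_def)
    then have "c * (fst u ^ 4 + snd u ^ 4) = 0"
      by (simp add: side_def cube_dir_def power_numeral_reduce algebra_simps)
    then have "c = 0 \<or> fst u ^ 4 + snd u ^ 4 = 0" by simp
    then show ?thesis
    proof
      assume "c = 0"
      with that show ?thesis unfolding F4_eq c_def[symmetric] by simp
    next
      assume "fst u ^ 4 + snd u ^ 4 = 0"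
      moreover have "0 \<le> fst u ^ 4" "0 \<le> snd u ^ 4" by simp_all
      ultimately have "fst u = 0" "snd u = 0" by (simp_all add: add_nonneg_eq_0_iff)
      then show ?thesis by (simp add: prod_eq_iff)
    qed
  qed
  then show ?thesis by (auto simp: Fix_def F4_eq)
qed

text \<open>
  The ball of radius \<open>r\<close> is mapped into itself, so the estimate can be iterated and the distance to \<open>p\<close>
  decays geometrically along orbits.
\<close>

lemma local_attractor_contraction:
  fixes f :: "'a::metric_space \<Rightarrow> 'a"
  assumes fixed: "f p = p" and "0 \<le> q" "q < 1" "0 < r"
    and contr: "\<And>x. x \<in> ball p r \<Longrightarrow> dist p (f x) \<le> q * dist p x"
  shows "local_attractor f p"
proof -
  have orbit: "dist p ((f ^^ n) x) \<le> q ^ n * dist p x" if "x \<in> ball p r" for x n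
  proof (induction n)
    case (Suc n)
    have "q ^ n * dist p x \<le> 1 * dist p x"
      using \<open>0 \<le> q\<close> \<open>q < 1\<close> by (intro mult_right_mono) (auto simp: power_le_one)
    with Suc that have "(f ^^ n) x \<in> ball p r" by simp
    then have "dist p (f ((f ^^ n) x)) \<le> q * dist p ((f ^^ n) x)" by (rule contr)
    also have "\<dots> \<le> q * (q ^ n * dist p x)" using Suc \<open>0 \<le> q\<close> by (rule mult_left_mono)
    finally show ?case by (simp add: mult.assoc)
  qed simp
  show ?thesis
    unfolding local_attractor_def
  proof (intro conjI allI impI)
    show "p \<in> Fix f" using fixed by (simp add: Fix_def)
    show "\<exists>\<delta>>0. \<forall>x\<in>ball p \<delta>. \<forall>n. (f ^^ n) x \<in> ball p \<epsilon>" if "0 < \<epsilon>" for \<epsilon>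
    proof (intro exI[of _ "min r \<epsilon>"] conjI ballI allI)
      fix x n assume x: "x \<in> ball p (min r \<epsilon>)"
      have "q ^ n * dist p x \<le> 1 * dist p x"
        using \<open>0 \<le> q\<close> \<open>q < 1\<close> by (intro mult_right_mono) (auto simp: power_le_one)
      with orbit[of x n] x show "(f ^^ n) x \<in> ball p \<epsilon>" by simp
    qed (use \<open>0 < r\<close> that in simp)
    show "\<exists>\<delta>>0. \<forall>x\<in>ball p \<delta>. (\<lambda>n. (f ^^ n) x) \<longlonglongrightarrow> p"
    proof (intro exI[of _ r] conjI ballI)
      fix x assume x: "x \<in> ball p r"
      have "(\<lambda>n. q ^ n) \<longlonglongrightarrow> 0"
        using \<open>0 \<le> q\<close> \<open>q < 1\<close> by (intro LIMSEQ_power_zero) simp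
      then have "(\<lambda>n. q ^ n * dist p x) \<longlonglongrightarrow> 0" by (rule tendsto_mult_left_zero)
      then have "(\<lambda>n. dist ((f ^^ n) x) p) \<longlonglongrightarrow> 0"
        by (rule Lim_null_comparison[rotated]) (simp add: orbit[OF x] dist_commute[of _ p])
      then show "(\<lambda>n. (f ^^ n) x) \<longlonglongrightarrow> p" by (rule tendsto_dist_iff[THEN iffD2])
    qed fact
  qed
qed

lemma norm_cube_dir_le: "norm (cube_dir u) \<le> norm u ^ 3"
proof (rule power2_le_imp_le)
  define a b where "a = (fst u)\<^sup>2" and "b = (snd u)\<^sup>2"
  have "0 \<le> a" "0 \<le> b" by (simp_all add: a_def b_def)
  have "(norm (cube_dir u))\<^sup>2 = a ^ 3 + b ^ 3"
    by (simp add: norm_plane_squared cube_dir_def a_def b_def flip: power_mult)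
  also have "\<dots> \<le> (a + b) ^ 3"
    using \<open>0 \<le> a\<close> \<open>0 \<le> b\<close> by (simp add: power3_eq_cube algebra_simps)
  also have "\<dots> = ((norm u)\<^sup>2) ^ 3"
    by (simp add: norm_plane_squared a_def b_def)
  also have "\<dots> = (norm u ^ 3)\<^sup>2"
    by (simp flip: power_mult)
  finally show "(norm (cube_dir u))\<^sup>2 \<le> (norm u ^ 3)\<^sup>2" .
qed simp

text \<open>
  The estimate \<open>\<parallel>F4 k u\<parallel> \<le> k \<parallel>u\<parallel>\<^sup>3\<close> gives the contraction factor one half as soon as
  \<open>k \<parallel>u\<parallel>\<^sup>2 \<le> 1 / 2\<close>. Since \<open>k \<ge> 1\<close>, the ball of radius \<open>1 / (2 k)\<close> consists of vectors of norm at most one,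
  for which \<open>k \<parallel>u\<parallel> \<le> 1 / 2\<close> implies this.
\<close>

lemma local_attractor_F4:
  assumes "1 \<le> k"
  shows "local_attractor (F4 k) 0"
proof (rule local_attractor_contraction[where q = "1/2" and r = "1 / (2 * k)"])
  fix u :: plane assume "u \<in> ball 0 (1 / (2 * k))"
  then have small: "k * norm u \<le> 1 / 2" using assms by (simp add: field_simps)
  moreover have "1 * norm u \<le> k * norm u" using assms by (intro mult_right_mono) auto
  ultimately have "norm u \<le> 1" by linarith
  have "norm (F4 k u) = k / (1 + (norm u)\<^sup>2) * norm (cube_dir u)"
    using assms by (simp add: F4_eq)
  also have "\<dots> \<le> k * norm u ^ 3"
    using assms norm_cube_dir_le by (intro mult_mono) (auto simp: divide_le_eq add_pos_nonneg mult_le_cancel_left1)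
  also have "\<dots> = (k * norm u) * (norm u * norm u)" by (simp add: power3_eq_cube)
  also have "\<dots> \<le> 1 / 2 * (1 * norm u)"
    using small \<open>norm u \<le> 1\<close> assms by (intro mult_mono) auto
  finally show "dist 0 (F4 k u) \<le> 1 / 2 * dist 0 u" by simp
qed (use assms in \<open>auto simp: F4_eq\<close>)

section \<open>Equivariance, the periodic orbit and the sectors\<close>

lemma F4_R4: "F4 k (R4 u) = R4 (F4 k u)"
  by (cases u) (simp add: F4_def R4_def ac_simps)

lemma F4_R4_funpow: "F4 k ((R4 ^^ n) u) = (R4 ^^ n) (F4 k u)"
  by (induction n) (simp_all add: F4_R4)

lemma Z4_equivariant_F4: "Z4_equivariant (F4 k)"
  by (auto simp: Z4_equivariant_def Z4_def F4_R4_funpow)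

lemma R4_funpow_4: "(R4 ^^ 4) u = u"
proof -
  have "(R4 ^^ Suc (Suc (Suc (Suc 0)))) (a, b) = (a, b)" for a b
    by (simp add: R4_def)
  then show ?thesis by (cases u) (simp add: numeral_eq_Suc)
qed

text \<open>
  If the map rotates one point, then by equivariance it rotates every point of the orbit in the same way.
\<close>

lemma F4_funpow_eq_R4_funpow:
  assumes "F4 k u = R4 u"
  shows "(F4 k ^^ n) u = (R4 ^^ n) u"
proof (induction n)
  case (Suc n)
  then have "(F4 k ^^ Suc n) u = (R4 ^^ n) (R4 u)"
    by (simp add: F4_R4_funpow assms)
  then show ?case by (simp add: funpow_swap1)
qed simp

text \<open>
  On the axis the image is the rotated point times \<open>k x\<^sup>2 / (1 + x\<^sup>2)\<close>, and the hypothesis says that this factor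
  is one.
\<close>

lemma F4_eq_R4_on_axis:
  assumes "x\<^sup>2 * (k - 1) = 1"
  shows "F4 k (x, 0) = R4 (x, 0)"
proof -
  have "k * x ^ 3 = x * (1 + x\<^sup>2)"
    using arg_cong[OF assms, of "\<lambda>t. x * t"]
    by (simp add: algebra_simps power2_eq_square power3_eq_cube)
  moreover have "1 + x\<^sup>2 \<noteq> 0" by (metis add_pos_nonneg less_irrefl zero_le_power2 zero_less_one)
  ultimately show ?thesis by (simp add: F4_def R4_def)
qed

lemma sector_1_eq: "sector 1 = {u. 0 < fst u \<and> 0 < snd u}"
proof (intro set_eqI iffI)
  fix u assume "u \<in> sector 1"
  then show "u \<in> {u. 0 < fst u \<and> 0 < snd u}"
    by (auto simp: sector_1 cos_gt_zero sin_gt_zero2)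
next
  fix u :: plane assume "u \<in> {u. 0 < fst u \<and> 0 < snd u}"
  then obtain x y where u: "u = (x, y)" "0 < x" "0 < y" by (cases u) auto
  then have "0 < norm u" by (auto simp: zero_prod_def)
  moreover have "u = (norm u * cos (arctan (y / x)), norm u * sin (arctan (y / x)))"
  proof -
    have "1 + (y / x)\<^sup>2 = (norm u)\<^sup>2 / x\<^sup>2"
      using u by (simp add: norm_plane_squared field_simps)
    then have "sqrt (1 + (y / x)\<^sup>2) = norm u / x"
      using u by (simp add: real_sqrt_divide)
    then show ?thesis using u \<open>0 < norm u\<close> by (simp add: cos_arctan sin_arctan)
  qed
  moreover have "0 < arctan (y / x)" "arctan (y / x) < pi / 2"
    using u arctan_ubound by auto
  ultimately show "u \<in> sector 1" unfolding sector_1 by blast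
qed

text \<open>
  Membership in the open quadrants is a matter of signs of coordinates, which cubing and positive factors
  preserve. So the first sector is the full preimage of the second, and surjectivity turns this into a
  statement about images.
\<close>

lemma F4_image_sector_1:
  assumes "0 < k"
  shows "F4 k ` sector 1 = R4 ` sector 1"
proof -
  have R4_mem: "v \<in> R4 ` sector 1 \<longleftrightarrow> fst v < 0 \<and> 0 < snd v" for v
  proof
    assume "fst v < 0 \<and> 0 < snd v"
    then have "v = R4 (snd v, - fst v)" "(snd v, - fst v) \<in> sector 1"
      by (auto simp: R4_def sector_1_eq)
    then show "v \<in> R4 ` sector 1" by blast
  qed (auto simp: R4_def sector_1_eq)
  have "F4 k u \<in> R4 ` sector 1 \<longleftrightarrow> u \<in> sector 1" for u
  proof -
    have "0 < k / (1 + (norm u)\<^sup>2)" using assms by (simp add: add_pos_nonneg)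
    then obtain c where "0 < c" "F4 k u = c *\<^sub>R cube_dir u" by (metis F4_eq)
    then show ?thesis
      unfolding R4_mem by (auto simp: sector_1_eq cube_dir_def zero_less_mult_iff mult_less_0_iff)
  qed
  then have "sector 1 = F4 k -` (R4 ` sector 1)" by blast
  then show ?thesis using surj_F4[OF assms] by (metis surj_image_vimage_eq)
qed

lemma sector_eq_rotation: "sector (int n + 1) = (R4 ^^ n) ` sector 1"
proof -
  have "(R4 ^^ (4 * m)) u = u" for m u
    by (induction m) (simp_all add: funpow_add R4_funpow_4)
  then have "(R4 ^^ (n mod 4)) u = (R4 ^^ n) u" for u
    by (metis comp_apply funpow_add mod_mult_div_eq)
  moreover have "nat (int n mod 4) = n mod 4"
    by (simp add: nat_mod_distrib)
  ultimately show ?thesis by (simp add: sector_def)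
qed

lemma F4_image_sector:
  assumes "0 < k" "1 \<le> j"
  shows "F4 k ` sector j = sector (j + 1)"
proof -
  obtain n where j: "j = int n + 1" using assms(2) by (metis add.commute zle_iff_zadd)
  have "F4 k ` sector j = (R4 ^^ n) ` (F4 k ` sector 1)"
    by (simp add: j sector_eq_rotation image_image F4_R4_funpow)
  also have "\<dots> = (R4 ^^ Suc n) ` sector 1"
    using assms by (simp add: F4_image_sector_1 image_image funpow_Suc_right del: funpow.simps)
  also have "\<dots> = sector (j + 1)"
    using sector_eq_rotation[of "Suc n"] by (simp add: j add.commute)
  finally show ?thesis .
qed

section \<open>The image of the unit circle\<close>

lemma F4_circle: "F4 k (cos t, sin t) = (k / 2) *\<^sub>R (- (sin t ^ 3), cos t ^ 3)"
  by (simp add: F4_eq norm_plane_squared cube_dir_def)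

text \<open>
  The ray through \<open>u\<close> is the image of the ray through \<open>root_dir u\<close>, which contains a point of the circle.
\<close>

lemma circle_image_meets_ray:
  assumes "0 < k" "u \<noteq> 0"
  obtains s where "0 \<le> s" "s < 2 * pi" "F4 k (cos s, sin s) \<in> ray u"
proof -
  define w where "w = root_dir u"
  have "w \<noteq> 0" using assms(2) by (metis w_def cube_dir_0 cube_dir_root_dir)
  then have "(fst (sgn w))\<^sup>2 + (snd (sgn w))\<^sup>2 = 1"
    by (simp add: norm_sgn flip: norm_plane_squared)
  then obtain s where s: "0 \<le> s" "s < 2 * pi" "fst (sgn w) = cos s" "snd (sgn w) = sin s"
    using sincos_total_2pi by metis
  then have "F4 k (cos s, sin s) = F4 k (inverse (norm w) *\<^sub>R w)"
    by (metis prod.collapse sgn_div_norm)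
  also have "\<dots> \<in> F4 k ` ray w"
    unfolding ray_def by (intro imageI CollectI exI[of _ "inverse (norm w)"]) simp
  also have "\<dots> = ray u" using assms by (simp add: F4_image_ray w_def)
  finally show thesis using s that by blast
qed

text \<open>
  If the curve is at a positive multiple of \<open>u\<close> at time \<open>s\<close>, then the side of \<open>u\<close> on which the curve lies at
  time \<open>t\<close> is decided by the determinant of its values at \<open>s\<close> and \<open>t\<close>. That determinant is a
  difference of cubes and has the sign of \<open>sin (t - s)\<close>, so it changes sign at \<open>s\<close>. Unlike an
  argument by the derivative, this also covers the multiples of \<open>\<pi> / 2\<close>, where the velocity is zero.
\<close>

lemma circle_image_crosses:
  assumes "0 < k" "F4 k (cos s, sin s) \<in> ray u"
  shows "crosses_at (\<lambda>t. F4 k (cos t, sin t)) u s"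
proof -
  let ?c = "\<lambda>t. F4 k (cos t, sin t)"
  obtain l where "0 \<le> l" and l: "?c s = l *\<^sub>R u" using assms(2) by (auto simp: ray_def)
  have nz: "?c s \<noteq> 0"
    using assms(1) by (auto simp: F4_circle zero_prod_def dest: sin_zero_abs_cos_one)
  with l \<open>0 \<le> l\<close> have "0 < l" by (cases "l = 0") auto
  have side: "l * side u (?c t) = (k / 2)\<^sup>2 * ((cos s * sin t) ^ 3 - (sin s * cos t) ^ 3)" for t
  proof -
    have "l * side u (?c t) = side (?c s) (?c t)"
      unfolding l by (simp add: side_def algebra_simps)
    also have "\<dots> = (k / 2)\<^sup>2 * ((cos s * sin t) ^ 3 - (sin s * cos t) ^ 3)"
      by (simp add: F4_circle side_def power_mult_distrib power2_eq_square algebra_simps)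
    finally show ?thesis .
  qed
  have "0 < (k / 2)\<^sup>2" using assms(1) by simp
  have pos: "0 < side u (?c t)" if "0 < sin (t - s)" for t
  proof -
    have "sin s * cos t < cos s * sin t" using that by (simp add: sin_diff mult.commute)
    then have "0 < l * side u (?c t)"
      unfolding side using \<open>0 < (k / 2)\<^sup>2\<close> cube_less_iff by (intro mult_pos_pos) simp_all
    with \<open>0 < l\<close> show ?thesis by (simp add: zero_less_mult_iff)
  qed
  have neg: "side u (?c t) < 0" if "sin (t - s) < 0" for t
  proof -
    have "cos s * sin t < sin s * cos t" using that by (simp add: sin_diff mult.commute)
    then have "l * side u (?c t) < 0"
      unfolding side using \<open>0 < (k / 2)\<^sup>2\<close> cube_less_iff by (intro mult_pos_neg) simp_all
    with \<open>0 < l\<close> show ?thesis by (simp add: mult_less_0_iff)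
  qed
  have "\<forall>\<^sub>F t in at_left s. side u (?c t) < 0"
  proof (rule eventually_at_leftI[of "s - pi"])
    fix t assume "t \<in> {s - pi<..<s}"
    then have "0 < sin (s - t)" by (intro sin_gt_zero) auto
    then have "sin (t - s) < 0" using sin_minus[of "s - t"] by simp
    then show "side u (?c t) < 0" by (rule neg)
  qed simp
  moreover have "\<forall>\<^sub>F t in at_right s. 0 < side u (?c t)"
    by (rule eventually_at_rightI[of s "s + pi"]) (auto intro!: pos sin_gt_zero)
  ultimately show ?thesis using assms(2) nz by (simp add: crosses_at_def)
qed

lemma circle_image_goes_across:
  assumes "0 < k" "u \<noteq> 0"
  shows "goes_across {0..<2 * pi} (\<lambda>\<theta>. F4 k (cos \<theta>, sin \<theta>)) u"
  unfolding goes_across_def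
proof (intro conjI ballI impI)
  show "\<exists>s\<in>{0..<2 * pi}. F4 k (cos s, sin s) \<in> ray u"
    using circle_image_meets_ray[OF assms] by (metis atLeastLessThan_iff)
qed (rule circle_image_crosses[OF assms(1)])

lemma independent_if_side_nonzero:
  assumes "side u v \<noteq> 0"
  shows "v \<noteq> u" "independent {v, u}"
proof -
  show "v \<noteq> u" using assms by (auto simp: side_def)
  have "u \<noteq> 0" using assms by (auto simp: side_def)
  moreover have "v \<notin> span {u}"
    using assms by (auto simp: span_singleton side_def)
  ultimately show "independent {v, u}"
    by (simp add: independent_insert)
qed

text \<open>
  The determinant of position and velocity is three times the square of \<open>k / 2 \<cdot> sin s \<cdot> cos s\<close>.
\<close>

lemma circle_image_transverse:
  assumes "k \<noteq> 0" "sin s \<noteq> 0" "cos s \<noteq> 0"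
  shows "transverse_to_rays_at (\<lambda>\<theta>. F4 k (cos \<theta>, sin \<theta>)) s"
  unfolding transverse_to_rays_at_def
proof (intro exI conjI allI impI)
  let ?v = "(k / 2) *\<^sub>R (- (3 * (sin s)\<^sup>2 * cos s), - (3 * (cos s)\<^sup>2 * sin s))"
  show "((\<lambda>\<theta>. F4 k (cos \<theta>, sin \<theta>)) has_vector_derivative ?v) (at s)"
    unfolding F4_circle
    by (auto intro!: derivative_eq_intros has_vector_derivative_Pair simp: has_real_derivative_iff_has_vector_derivative[symmetric])
  fix u assume "u \<noteq> 0 \<and> F4 k (cos s, sin s) \<in> ray u"
  then obtain l where l: "F4 k (cos s, sin s) = l *\<^sub>R u" by (auto simp: ray_def)
  have "l * side u ?v = side (F4 k (cos s, sin s)) ?v"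
    unfolding l by (simp add: side_def algebra_simps)
  also have "\<dots> = 3 * (k / 2 * (sin s * cos s))\<^sup>2 * ((sin s)\<^sup>2 + (cos s)\<^sup>2)"
  proof -
    have "K * - (x ^ 3) * (K * - (3 * y\<^sup>2 * x)) - K * y ^ 3 * (K * - (3 * x\<^sup>2 * y))
        = 3 * (K * (x * y))\<^sup>2 * (x\<^sup>2 + y\<^sup>2)" for K x y :: real
      by (simp add: power2_eq_square power3_eq_cube algebra_simps)
    then show ?thesis
      by (simp only: F4_circle side_def fst_scaleR snd_scaleR fst_conv snd_conv real_scaleR_def)
  qed
  also have "\<dots> \<noteq> 0" using assms by simp
  finally have "side u ?v \<noteq> 0" by auto
  then show "?v \<noteq> u" "independent {?v, u}" by (rule independent_if_side_nonzero)+
qed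

text \<open>
  The zeros of \<open>sin\<close> and \<open>cos\<close> together are those of \<open>sin (2 \<theta>)\<close>, that is, the multiples of \<open>\<pi> / 2\<close>.
\<close>

lemma sin_cos_nonzero:
  assumes "\<theta> \<in> {0..<2 * pi}" "\<forall>m\<in>{0, 1, 2, 3 :: nat}. \<theta> \<noteq> real m * pi / 2"
  shows "sin \<theta> \<noteq> 0" "cos \<theta> \<noteq> 0"
proof -
  have "sin (2 * \<theta>) \<noteq> 0"
  proof
    assume "sin (2 * \<theta>) = 0"
    then obtain i :: int where i: "2 * \<theta> = of_int i * pi" by (auto simp: sin_zero_iff_int2)
    with assms(1) have "0 \<le> real_of_int i * pi" "real_of_int i * pi < 4 * pi"
      unfolding atLeastLessThan_iff by linarith+
    then have "0 \<le> real_of_int i" "real_of_int i < 4"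
      using pi_gt_zero by (auto simp only: zero_le_mult_iff mult_less_cancel_right)
    then have "0 \<le> i" "i < 4" by simp_all
    then have "nat i \<in> {0, 1, 2, 3}" by auto
    moreover have "\<theta> = real (nat i) * pi / 2" using i \<open>0 \<le> i\<close> by simp
    ultimately show False using assms(2) by blast
  qed
  then show "sin \<theta> \<noteq> 0" "cos \<theta> \<noteq> 0" by (auto simp: sin_double)
qed

theorem proposition2p1:
  fixes k :: real
  assumes "1 < k" and "k < 2 / sqrt 3"
  shows
    "of_class_C1 (F4 k) \<and>
     (\<exists>G. homeomorphism UNIV UNIV (F4 k) G) \<and>
     Fix (F4 k) = {0} \<and>
     (let P = ((k - 1) powr (- 1 / 2), 0) in
        (F4 k ^^ 4) P = P \<and>
        (\<forall>j\<in>{2, 3}. (F4 k ^^ j) P = (R4 ^^ j) P \<and> (R4 ^^ j) P \<noteq> P)) \<and>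
     local_attractor (F4 k) 0 \<and>
     Z4_equivariant (F4 k) \<and>
     (\<forall>L. line_ray L \<longrightarrow>
        (\<exists>L'. line_ray L' \<and> L' \<noteq> L \<and> (\<exists>G. homeomorphism L L' (F4 k) G))) \<and>
     (\<forall>j\<in>{1..4}.
        F4 k ` closure (sector j) = closure (sector (j + 1)) \<and>
        F4 k ` frontier (sector j) = frontier (sector (j + 1))) \<and>
     (\<forall>u. u \<noteq> 0 \<longrightarrow> goes_across {0..<2 * pi} (\<lambda>\<theta>. F4 k (cos \<theta>, sin \<theta>)) u) \<and>
     (\<forall>\<theta>\<in>{0..<2 * pi}. (\<forall>m\<in>{0, 1, 2, 3 :: nat}. \<theta> \<noteq> real m * pi / 2) \<longrightarrow>
        transverse_to_rays_at (\<lambda>\<theta>. F4 k (cos \<theta>, sin \<theta>)) \<theta>)"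
proof (intro conjI)
  have "0 < k" using assms(1) by simp
  obtain G where G: "homeomorphism UNIV UNIV (F4 k) G"
    using homeomorphism_F4[OF \<open>0 < k\<close>] .
  then show "\<exists>G. homeomorphism UNIV UNIV (F4 k) G" by blast
  show "of_class_C1 (F4 k)" by (rule of_class_C1_F4)
  show "Fix (F4 k) = {0}" by (rule Fix_F4)
  show "local_attractor (F4 k) 0" using assms(1) by (intro local_attractor_F4) simp
  show "Z4_equivariant (F4 k)" by (rule Z4_equivariant_F4)
  show "let P = ((k - 1) powr (- 1 / 2), 0) in
        (F4 k ^^ 4) P = P \<and>
        (\<forall>j\<in>{2, 3}. (F4 k ^^ j) P = (R4 ^^ j) P \<and> (R4 ^^ j) P \<noteq> P)"
  proof -
    define x where "x = (k - 1) powr (- 1 / 2)"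
    have "x \<noteq> 0" using assms(1) by (simp add: x_def)
    have "x\<^sup>2 = (k - 1) powr (- 1)"
      unfolding x_def power2_eq_square powr_add[symmetric] by simp
    then have "x\<^sup>2 * (k - 1) = 1" using assms(1) by (simp add: powr_minus)
    then have "(F4 k ^^ j) (x, 0) = (R4 ^^ j) (x, 0)" for j
      by (intro F4_funpow_eq_R4_funpow F4_eq_R4_on_axis)
    moreover have "(R4 ^^ j) (x, 0) \<noteq> (x, 0)" if "j \<in> {2, 3}" for j
      using that \<open>x \<noteq> 0\<close> by (auto simp: numeral_eq_Suc R4_def)
    ultimately show ?thesis unfolding x_def[symmetric] Let_def by (simp add: R4_funpow_4)
  qed
  show "\<forall>L. line_ray L \<longrightarrow>
        (\<exists>L'. line_ray L' \<and> L' \<noteq> L \<and> (\<exists>G. homeomorphism L L' (F4 k) G))"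
  proof (intro allI impI)
    fix L assume "line_ray L"
    then obtain u where u: "u \<noteq> 0" "L = ray u" by (auto simp: line_ray_def)
    have "cube_dir u \<noteq> 0" using u(1) by (metis cube_dir_0 cube_dir_eq_iff)
    then have "line_ray (ray (cube_dir u))" unfolding line_ray_def by blast
    moreover have "homeomorphism L (ray (cube_dir u)) (F4 k) G"
      using homeomorphism_of_subsets[OF G _ _ F4_image_ray[OF \<open>0 < k\<close>]] u(2) by blast
    ultimately show "\<exists>L'. line_ray L' \<and> L' \<noteq> L \<and> (\<exists>G. homeomorphism L L' (F4 k) G)"
      using ray_cube_dir_neq[OF u(1)] u(2) by blast
  qed
  show "\<forall>j\<in>{1..4}.
        F4 k ` closure (sector j) = closure (sector (j + 1)) \<and>
        F4 k ` frontier (sector j) = frontier (sector (j + 1))"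
    using \<open>0 < k\<close> by (auto simp: homeomorphism_image_closure_frontier[OF G] F4_image_sector)
  show "\<forall>u. u \<noteq> 0 \<longrightarrow> goes_across {0..<2 * pi} (\<lambda>\<theta>. F4 k (cos \<theta>, sin \<theta>)) u"
    using \<open>0 < k\<close> by (simp add: circle_image_goes_across)
  show "\<forall>\<theta>\<in>{0..<2 * pi}. (\<forall>m\<in>{0, 1, 2, 3 :: nat}. \<theta> \<noteq> real m * pi / 2) \<longrightarrow>
        transverse_to_rays_at (\<lambda>\<theta>. F4 k (cos \<theta>, sin \<theta>)) \<theta>"
    using \<open>0 < k\<close> sin_cos_nonzero by (auto intro!: circle_image_transverse)
qed

end
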